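(* Let $Q_{n,j}$ ($n,j\ge0$) be the formal power series in $\mathbf x=(x_1,x_2,\dots)$ given by $Q_{n,j}=\sum_{\sigma\in\mathfrak S_n,\ \mathrm{exc}(\sigma)=j}F_{\mathrm{EXD}(\sigma),n}(\mathbf x)$, and let $H(z)=\sum_{n\ge0}h_n(\mathbf x)z^n$. Then $$\sum_{n,j\ge0}Q_{n,j}\,t^jz^n=\frac{(1-t)H(z)}{H(zt)-tH(z)}.$$
   Context: $\mathbf x=(x_1,x_2,\dots)$ is an infinite sequence of commuting indeterminates; $h_n(\mathbf x)=\sum_{1\le i_1\le\dots\le i_n}x_{i_1}\cdots x_{i_n}$ is the complete homogeneous symmetric function, $h_0=1$. $\mathfrak S_n$ is the set of permutations of $[n]=\{1,\dots,n\}$, and $\mathrm{exc}(\sigma)=|\{i\in[n-1]:\sigma(i)>i\}|$. Excedance-descent set: for $\sigma\in\mathfrak S_n$ let $\bar\sigma$ be the word obtained from $\sigma(1)\sigma(2)\cdots\sigma(n)$ by placing a bar over each letter $\sigma(i)$ with $\sigma(i)>i$ (e.g. $531462\mapsto\bar5\bar314\bar62$), viewed as a word over the ordered alphabet $\bar1<\bar2<\dots<\bar n<1<2<\dots<n$. Then $\mathrm{EXD}(\sigma)=\{i\in[n-1]:\bar\sigma_i>\bar\sigma_{i+1}\}$, where $\bar\sigma_i$ is the $i$th letter of $\bar\sigma$. For $n\ge1$ and $S\subseteq[n-1]$, $F_{S,n}(\mathbf x)=\sum x_{i_1}\cdots x_{i_n}$, summed over all sequences of positive integers $i_1\ge i_2\ge\dots\ge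 i_n$ such that $i_j>i_{j+1}$ whenever $j\in S$; and $F_{\emptyset,0}=1$ (so $Q_{0,0}=1$ and $Q_{0,j}=0$ for $j>0$). The identity is one of formal power series in $z$, where the denominator on the right has constant term $1-t$ (invertible in $\mathbb Q(t)$ or $\mathbb Z[[t]]$). *)

theory Defs
  imports
    "HOL-Library.Multiset"
    "HOL-Combinatorics.Permutations"
    "HOL-Computational_Algebra.Formal_Power_Series"
begin

text \<open>
  Formal power series in commuting indeterminates indexed by \<open>'v\<close> (possibly infinitely many),
  with coefficients in \<open>'a\<close>.  The monomial \<open>x\<^sub>v\<^sub>1 \<cdots> x\<^sub>v\<^sub>n\<close> is the multiset \<open>mset [v1, \<dots>, vn]\<close>, and a
  power series is an arbitrary function from monomials to coefficients.
\<close>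

typedef ('v, 'a) mvps = "UNIV :: ('v multiset \<Rightarrow> 'a) set"
  morphisms mcoeff Abs_mvps
  by simp

lemma mcoeff_Abs [simp]: "mcoeff (Abs_mvps f) = f"
  by (simp add: Abs_mvps_inverse)

lemma mvps_eqI: "(\<And>m. mcoeff f m = mcoeff g m) \<Longrightarrow> f = g"
  by (metis ext mcoeff_inject)

definition msplits :: "'v multiset \<Rightarrow> ('v multiset \<times> 'v multiset) set" where
  "msplits m = {(a, b). a + b = m}"

lemma finite_submultisets: "finite {a. a \<subseteq># (m :: 'v multiset)}"
proof -
  have "{a. a \<subseteq># m} \<subseteq> mset ` {xs. set xs \<subseteq> set_mset m \<and> length xs \<le> size m}"
  proof
    fix a assume "a \<in> {a. a \<subseteq># m}"
    hence a: "a \<subseteq># m" by simp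
    obtain xs where xs: "mset xs = a" using ex_mset by blast
    have "set xs \<subseteq> set_mset m" using set_mset_mono[OF a] xs by auto
    moreover have "length xs \<le> size m" using size_mset_mono[OF a] xs by auto
    ultimately show "a \<in> mset ` {xs. set xs \<subseteq> set_mset m \<and> length xs \<le> size m}"
      using xs by blast
  qed
  thus ?thesis by (rule finite_subset) (simp add: finite_lists_length_le)
qed

lemma finite_msplits [simp]: "finite (msplits m)"
proof -
  have "msplits m \<subseteq> {a. a \<subseteq># m} \<times> {a. a \<subseteq># m}"
    by (auto simp: msplits_def)
  thus ?thesis by (rule finite_subset) (simp add: finite_submultisets)
qed

instantiation mvps :: (type, comm_ring_1) comm_ring_1
begin

definition "0 = Abs_mvps (\<lambda>_. 0)"
definition "1 = Abs_mvps (\<lambda>m. if m = {#} then 1 else 0)"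
definition "f + g = Abs_mvps (\<lambda>m. mcoeff f m + mcoeff g m)"
definition "f - g = Abs_mvps (\<lambda>m. mcoeff f m - mcoeff g m)"
definition "- f = Abs_mvps (\<lambda>m. - mcoeff f m)"
definition "f * g = Abs_mvps (\<lambda>m. \<Sum>(a, b)\<in>msplits m. mcoeff f a * mcoeff g b)"

lemmas mvps_defs = zero_mvps_def one_mvps_def plus_mvps_def minus_mvps_def uminus_mvps_def
  times_mvps_def

instance
proof
  fix f g h :: "('a, 'b) mvps"
  show "f + g + h = f + (g + h)" "f + g = g + f" "0 + f = f" "- f + f = 0" "f - g = f + - g"
    by (auto intro!: mvps_eqI simp: mvps_defs)
  show "(0 :: ('a, 'b) mvps) \<noteq> 1"
  proof
    assume "(0 :: ('a, 'b) mvps) = 1"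
    hence "mcoeff (0 :: ('a, 'b) mvps) {#} = mcoeff 1 {#}" by simp
    thus False by (simp add: mvps_defs)
  qed
  show "f * g = g * f"
  proof (rule mvps_eqI)
    fix m
    show "mcoeff (f * g) m = mcoeff (g * f) m"
      unfolding times_mvps_def mcoeff_Abs
      by (rule sum.reindex_bij_witness[of _ prod.swap prod.swap])
         (auto simp: msplits_def ac_simps)
  qed
  show "(f + g) * h = f * h + g * h"
    by (rule mvps_eqI)
       (simp add: times_mvps_def plus_mvps_def case_prod_unfold distrib_right sum.distrib)
  show "1 * f = f"
  proof (rule mvps_eqI)
    fix m
    have "mcoeff (1 * f) m = (\<Sum>p\<in>msplits m. if p = ({#}, m) then mcoeff f m else 0)"
      unfolding times_mvps_def mcoeff_Abs one_mvps_def
      by (rule sum.cong) (auto simp: msplits_def split: if_splits)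
    also have "\<dots> = mcoeff f m"
      by (subst sum.delta, rule finite_msplits) (auto simp: msplits_def)
    finally show "mcoeff (1 * f) m = mcoeff f m" .
  qed
  show "f * g * h = f * (g * h)"
  proof (rule mvps_eqI)
    fix m
    have "mcoeff (f * g * h) m =
        (\<Sum>p\<in>msplits m. \<Sum>q\<in>msplits (fst p). mcoeff f (fst q) * mcoeff g (snd q) * mcoeff h (snd p))"
      by (simp add: times_mvps_def case_prod_unfold sum_distrib_right)
    also have "\<dots> = (\<Sum>(p, q)\<in>Sigma (msplits m) (\<lambda>p. msplits (fst p)).
        mcoeff f (fst q) * mcoeff g (snd q) * mcoeff h (snd p))"
      by (rule sum.Sigma) auto
    also have "\<dots> = (\<Sum>(p, q)\<in>Sigma (msplits m) (\<lambda>p. msplits (snd p)).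
        mcoeff f (fst p) * (mcoeff g (fst q) * mcoeff h (snd q)))"
      by (rule sum.reindex_bij_witness
            [of _ "\<lambda>(p, q). ((fst p + fst q, snd q), (fst p, fst q))"
                  "\<lambda>(p, q). ((fst q, snd q + snd p), (snd q, snd p))"])
         (auto simp: msplits_def ac_simps)
    also have "\<dots> = (\<Sum>p\<in>msplits m. \<Sum>q\<in>msplits (snd p).
        mcoeff f (fst p) * (mcoeff g (fst q) * mcoeff h (snd q)))"
      by (rule sum.Sigma[symmetric]) auto
    also have "\<dots> = mcoeff (f * (g * h)) m"
      by (simp add: times_mvps_def case_prod_unfold sum_distrib_left)
    finally show "mcoeff (f * g * h) m = mcoeff (f * (g * h)) m" .
  qed
qed

end

text \<open>
  The formal sum of \<open>x\<^sub>w\<^sub>1 \<cdots> x\<^sub>w\<^sub>n\<close> over all words \<open>w\<close> in \<open>A\<close>.  Only finitely many words share a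
  given monomial, so the cardinality is that of a finite set even when \<open>A\<close> is infinite.
\<close>

definition word_series :: "'v list set \<Rightarrow> ('v, 'a :: comm_ring_1) mvps" where
  "word_series A = Abs_mvps (\<lambda>m. of_nat (card {w \<in> A. mset w = m}))"

lemma finite_words_of_monomial: "finite {w \<in> A. mset w = m}"
  by (rule finite_subset[OF _ mset_eq_finite[of "SOME w. mset w = m"]])
     (use someI_ex[OF ex_mset[of m]] in auto)

text \<open>
  Variables are indexed by the positive integers; the indeterminate with index 0 is available in
  the type but occurs in none of the series below.  Words \<open>i\<^sub>1 \<dots> i\<^sub>n\<close> are 0-based lists, so \<open>i\<^sub>j\<close> is
  \<open>w ! (j - 1)\<close>.
\<close>

type_synonym xps = "(nat, int) mvps"

definition hsym :: "nat \<Rightarrow> xps" where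
  "hsym n = word_series {w. length w = n \<and> (\<forall>i\<in>set w. 1 \<le> i) \<and> sorted w}"

definition Fquasi :: "nat set \<Rightarrow> nat \<Rightarrow> xps" where
  "Fquasi S n = word_series {w. length w = n \<and> (\<forall>i\<in>set w. 1 \<le> i) \<and>
     (\<forall>j\<in>{1..<n}. w ! (j - 1) \<ge> w ! j) \<and>
     (\<forall>j\<in>S. w ! (j - 1) > w ! j)}"

definition exc :: "nat \<Rightarrow> (nat \<Rightarrow> nat) \<Rightarrow> nat" where
  "exc n \<sigma> = card {i \<in> {1..<n}. \<sigma> i > i}"

datatype letter = Barred nat | Plain nat

fun letter_less :: "letter \<Rightarrow> letter \<Rightarrow> bool" where
  "letter_less (Barred a) (Barred b) \<longleftrightarrow> a < b"
| "letter_less (Barred a) (Plain b) \<longleftrightarrow> True"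
| "letter_less (Plain a) (Barred b) \<longleftrightarrow> False"
| "letter_less (Plain a) (Plain b) \<longleftrightarrow> a < b"

definition bar_word :: "(nat \<Rightarrow> nat) \<Rightarrow> nat \<Rightarrow> letter" where
  "bar_word \<sigma> i = (if \<sigma> i > i then Barred (\<sigma> i) else Plain (\<sigma> i))"

definition EXD :: "nat \<Rightarrow> (nat \<Rightarrow> nat) \<Rightarrow> nat set" where
  "EXD n \<sigma> = {i \<in> {1..<n}. letter_less (bar_word \<sigma> (i + 1)) (bar_word \<sigma> i)}"

definition Qeuler :: "nat \<Rightarrow> nat \<Rightarrow> xps" where
  "Qeuler n j = (\<Sum>\<sigma> | \<sigma> permutes {1..n} \<and> exc n \<sigma> = j. Fquasi (EXD n \<sigma>) n)"

text \<open>
  The ring of the identity is \<open>\<int>[[x]][[t]][[z]]\<close>, i.e. \<open>xps fps fps\<close>: the inner series variable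
  is \<open>t\<close>, the outer one is \<open>z\<close>.
\<close>

definition tvar :: "xps fps fps" where
  "tvar = fps_const fps_X"

definition zvar :: "xps fps fps" where
  "zvar = fps_X"

definition Hgen :: "xps fps fps" where
  "Hgen = Abs_fps (\<lambda>n. fps_const (hsym n))"

definition Qgen :: "xps fps fps" where
  "Qgen = Abs_fps (\<lambda>n. Abs_fps (\<lambda>j. Qeuler n j))"

text \<open>
  The quotient by a unit of a commutative ring (the library's division on power series needs a
  coefficient type with an \<open>inverse\<close> operation).  It is meaningful only if \<open>d dvd 1\<close>.
\<close>

definition unit_quot :: "'a :: comm_ring_1 \<Rightarrow> 'a \<Rightarrow> 'a" where
  "unit_quot a d = a * (THE u. d * u = 1)"

lemma unit_quot_eq_iff:
  assumes "d dvd 1"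
  shows "q = unit_quot a d \<longleftrightarrow> q * d = a"
proof -
  obtain u where u: "d * u = 1" using assms by (metis dvdE)
  have "(THE u. d * u = 1) = u"
  proof (rule the_equality)
    show "d * u = 1" by (fact u)
    fix v assume v: "d * v = 1"
    have "v = v * (d * u)" using u by simp
    also have "\<dots> = (d * v) * u" by (simp only: ac_simps)
    finally show "v = u" using v by simp
  qed
  hence *: "unit_quot a d = a * u" by (simp add: unit_quot_def)
  have "a * u * d = a * (d * u)" "q * d * u = q * (d * u)" by (simp_all only: ac_simps)
  thus ?thesis using u * by auto
qed

end

theory Submission
  imports Defs "HOL-Library.Product_Lexorder"
begin

text \<open>
  Fix a monomial \<open>m\<close>, i.e. a weakly decreasing word, which cuts the positions \<open>1, \<dots>, n\<close> into
  blocks, one for each letter \<open>v\<close>, of size \<open>m v\<close>.  A permutation \<open>\<sigma>\<close> contributes to the coefficient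
  of \<open>m\<close> iff its barred word increases along each block, and then \<open>\<sigma>\<close> is determined by recording for
  every value its block and whether it is barred.  The admissible records are those in which
  every value is chosen independently from an explicit set, so the coefficient is
  \<open>[y\<^sup>m] \<Prod>\<^sub>v (L\<^sub>v - t y\<^sub>v) L\<^sub>v\<^bsup>m v - 1\<^esup>\<close> with \<open>L\<^sub>v = t \<Sum>\<^sub>k\<^sub>\<ge>\<^sub>v y\<^sub>k + \<Sum>\<^sub>k\<^sub>\<le>\<^sub>v y\<^sub>k\<close>.

  Let \<open>M\<close> be the series with coefficients \<open>[y\<^sup>m] \<Prod>\<^sub>v L\<^sub>v\<^bsup>m v\<^esup>\<close> and let
  \<open>E(u) = \<Prod>\<^sub>v (1 - u x\<^sub>v) = 1/H(u)\<close>.  Then \<open>M E(u)\<close> has coefficients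
  \<open>[y\<^sup>m] \<Prod>\<^sub>v (L\<^sub>v - u y\<^sub>v) L\<^sub>v\<^bsup>m v - 1\<^esup>\<close>, so \<open>Q = M E(t)\<close>.  For \<open>m \<noteq> 1\<close> the product telescopes to
  \<open>\<Prod>\<^sub>v (L\<^sub>v - y\<^sub>v) = t \<Prod>\<^sub>v (L\<^sub>v - t y\<^sub>v)\<close>, whence \<open>M (E(1) - t E(t)) = 1 - t\<close>.  Multiplying by \<open>H(1)\<close>
  and \<open>E(t) H(t) = 1\<close> gives \<open>Q (H(t) - t H(1)) = (1 - t) H(1)\<close>.  The variable \<open>z\<close> only records the
  degree and is put back at the end.
\<close>

section \<open>Monomials and substitutions in multivariate power series\<close>

lemma mcoeff_zero [simp]: "mcoeff 0 m = 0"
  and mcoeff_one: "mcoeff 1 m = (if m = {#} then 1 else 0)"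
  and mcoeff_add [simp]: "mcoeff (f + g) m = mcoeff f m + mcoeff g m"
  and mcoeff_diff [simp]: "mcoeff (f - g) m = mcoeff f m - mcoeff g m"
  and mcoeff_mult: "mcoeff (f * g) m = (\<Sum>(a, b)\<in>msplits m. mcoeff f a * mcoeff g b)"
  by (simp_all add: mvps_defs)

lemma mcoeff_sum [simp]: "mcoeff (sum f A) m = (\<Sum>x\<in>A. mcoeff (f x) m)"
  by (induction A rule: infinite_finite_induct) auto

definition mmonom :: "'a::comm_ring_1 \<Rightarrow> 'v multiset \<Rightarrow> ('v, 'a) mvps" where
  "mmonom c a = Abs_mvps (\<lambda>m. if m = a then c else 0)"

abbreviation mconst :: "'a::comm_ring_1 \<Rightarrow> ('v, 'a) mvps" where
  "mconst c \<equiv> mmonom c {#}"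

lemma mcoeff_mmonom: "mcoeff (mmonom c a) m = (if m = a then c else 0)"
  by (simp add: mmonom_def)

lemma mconst_one: "mconst 1 = 1"
  by (rule mvps_eqI) (simp add: mcoeff_mmonom mcoeff_one)

lemma mcoeff_mmonom_mult:
  "mcoeff (mmonom c a * f) m = (if a \<subseteq># m then c * mcoeff f (m - a) else 0)"
proof -
  have "mcoeff (mmonom c a * f) m =
      (\<Sum>p\<in>msplits m. if p = (a, m - a) then c * mcoeff f (m - a) else 0)"
    unfolding mcoeff_mult by (rule sum.cong) (auto simp: msplits_def mcoeff_mmonom split: if_splits)
  also have "\<dots> = (if (a, m - a) \<in> msplits m then c * mcoeff f (m - a) else 0)"
    by (rule sum.delta) simp
  also have "(a, m - a) \<in> msplits m \<longleftrightarrow> a \<subseteq># m"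
    unfolding msplits_def
    by (auto intro: subset_mset.add_diff_inverse) (metis mset_subset_eq_add_left)
  finally show ?thesis by simp
qed

lemma mcoeff_mconst_mult: "mcoeff (mconst c * f) m = c * mcoeff f m"
  by (simp add: mcoeff_mmonom_mult)

lemma mmonom_mult: "mmonom c a * mmonom d b = mmonom (c * d) (a + b)"
  by (rule mvps_eqI) (auto simp: mcoeff_mmonom_mult mcoeff_mmonom)

lemma prod_mmonom: "(\<Prod>x\<in>A. mmonom (c x) (a x)) = mmonom (\<Prod>x\<in>A. c x) (\<Sum>x\<in>A. a x)"
  by (induction A rule: infinite_finite_induct) (auto simp: mmonom_mult simp flip: mconst_one)

lemma mconst_dvd_one:
  assumes "c dvd 1"
  shows "(mconst c :: ('v, 'a::comm_ring_1) mvps) dvd 1"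
proof -
  obtain d where "1 = c * d" using assms by (rule dvdE)
  hence "1 = mconst c * (mconst d :: ('v, 'a) mvps)"
    by (simp add: mmonom_mult flip: mconst_one)
  thus ?thesis by (rule dvdI)
qed

definition var_sum :: "'v set \<Rightarrow> ('v, 'a::comm_ring_1) mvps" where
  "var_sum A = Abs_mvps (\<lambda>m. if \<exists>v\<in>A. m = {#v#} then 1 else 0)"

lemma mcoeff_var_sum: "mcoeff (var_sum A) m = (if \<exists>v\<in>A. m = {#v#} then 1 else 0)"
  by (simp add: var_sum_def)

lemma var_sum_insert: "v \<notin> A \<Longrightarrow> var_sum (insert v A) = mmonom 1 {#v#} + var_sum A"
  by (rule mvps_eqI) (auto simp: mcoeff_var_sum mcoeff_mmonom)

lemma sum_mmonom_singleton:
  assumes "finite A"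
  shows "(\<Sum>v\<in>A. mmonom c {#v#}) = mconst c * var_sum A"
  using assms
proof induction
  case empty
  show ?case by (rule mvps_eqI) (simp add: mcoeff_mconst_mult mcoeff_var_sum)
next
  case (insert v A)
  thus ?case by (simp add: var_sum_insert distrib_left mmonom_mult)
qed

definition restrict_vars :: "'v set \<Rightarrow> ('v, 'a::comm_ring_1) mvps \<Rightarrow> ('v, 'a) mvps" where
  "restrict_vars V f = Abs_mvps (\<lambda>m. if set_mset m \<subseteq> V then mcoeff f m else 0)"

lemma mcoeff_restrict_vars:
  "mcoeff (restrict_vars V f) m = (if set_mset m \<subseteq> V then mcoeff f m else 0)"
  by (simp add: restrict_vars_def)

lemma restrict_vars_one: "restrict_vars V 1 = 1"
  by (rule mvps_eqI) (simp add: mcoeff_restrict_vars mcoeff_one)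

lemma restrict_vars_add: "restrict_vars V (f + g) = restrict_vars V f + restrict_vars V g"
  and restrict_vars_diff: "restrict_vars V (f - g) = restrict_vars V f - restrict_vars V g"
  by (auto intro!: mvps_eqI simp: mcoeff_restrict_vars)

lemma restrict_vars_mult: "restrict_vars V (f * g) = restrict_vars V f * restrict_vars V g"
proof (rule mvps_eqI)
  fix m
  have "(\<Sum>p\<in>msplits m. mcoeff (restrict_vars V f) (fst p) * mcoeff (restrict_vars V g) (snd p)) =
     (\<Sum>p\<in>msplits m. if set_mset m \<subseteq> V then mcoeff f (fst p) * mcoeff g (snd p) else 0)"
    by (rule sum.cong) (auto simp: mcoeff_restrict_vars msplits_def)
  thus "mcoeff (restrict_vars V (f * g)) m = mcoeff (restrict_vars V f * restrict_vars V g) m"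
    by (simp add: mcoeff_mult mcoeff_restrict_vars case_prod_unfold)
qed

lemma restrict_vars_prod: "restrict_vars V (\<Prod>x\<in>A. f x) = (\<Prod>x\<in>A. restrict_vars V (f x))"
  by (induction A rule: infinite_finite_induct) (simp_all add: restrict_vars_one restrict_vars_mult)

lemma restrict_vars_prod_mset:
  "restrict_vars V (\<Prod>x\<in>#M. f x) = (\<Prod>x\<in>#M. restrict_vars V (f x))"
  by (induction M) (simp_all add: restrict_vars_one restrict_vars_mult)

lemma restrict_vars_mmonom: "set_mset a \<subseteq> V \<Longrightarrow> restrict_vars V (mmonom c a) = mmonom c a"
  by (rule mvps_eqI) (auto simp: mcoeff_restrict_vars mcoeff_mmonom)

lemma restrict_vars_var_sum: "restrict_vars V (var_sum A) = var_sum (A \<inter> V)"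
  by (rule mvps_eqI) (auto simp: mcoeff_restrict_vars mcoeff_var_sum)

section \<open>Complete and elementary symmetric series\<close>

definition hser :: "'a::comm_ring_1 \<Rightarrow> ('v, 'a) mvps" where
  "hser u = Abs_mvps (\<lambda>m. u ^ size m)"

definition eser :: "'a::comm_ring_1 \<Rightarrow> ('v, 'a) mvps" where
  "eser u = Abs_mvps (\<lambda>m. if m = mset_set (set_mset m) then (- u) ^ size m else 0)"

lemma mset_set_subseteq_iff:
  "finite S \<Longrightarrow> mset_set S \<subseteq># m \<longleftrightarrow> S \<subseteq> set_mset m"
  by (metis finite_set_mset finite_set_mset_mset_set mset_set_set_mset_msubset set_mset_mono
      subset_imp_msubset_mset_set subset_mset.order_trans)

lemma mcoeff_mult_eser:
  "mcoeff (f * eser u) m =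
     (\<Sum>S\<in>Pow (set_mset m). mcoeff f (m - mset_set S) * (- u) ^ card S)"
proof -
  let ?split = "\<lambda>S. (m - mset_set S, mset_set S)"
  have fin: "finite S" if "S \<in> Pow (set_mset m)" for S
    using that by (auto intro: finite_subset)
  have "mcoeff (f * eser u) m = (\<Sum>(a, b)\<in>msplits m. mcoeff f a * mcoeff (eser u) b)"
    by (rule mcoeff_mult)
  also have "\<dots> = (\<Sum>(a, b)\<in>?split ` Pow (set_mset m). mcoeff f a * mcoeff (eser u) b)"
  proof (rule sum.mono_neutral_right)
    show "?split ` Pow (set_mset m) \<subseteq> msplits m"
      using fin by (auto simp: msplits_def mset_set_subseteq_iff)
    have "(a, b) \<in> ?split ` Pow (set_mset m)"
      if "(a, b) \<in> msplits m" "b = mset_set (set_mset b)" for a b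
      using that by (intro image_eqI[of _ _ "set_mset b"]) (auto simp: msplits_def)
    thus "\<forall>p\<in>msplits m - ?split ` Pow (set_mset m).
        (case p of (a, b) \<Rightarrow> mcoeff f a * mcoeff (eser u) b) = 0"
      by (fastforce simp: eser_def)
  qed simp
  also have "\<dots> = (\<Sum>S\<in>Pow (set_mset m). mcoeff f (m - mset_set S) * mcoeff (eser u) (mset_set S))"
    using fin by (subst sum.reindex) (auto intro!: inj_onI)
  also have "\<dots> = (\<Sum>S\<in>Pow (set_mset m). mcoeff f (m - mset_set S) * (- u) ^ card S)"
    using fin by (intro sum.cong) (auto simp: eser_def)
  finally show ?thesis .
qed

lemma hser_mult_eser: "hser u * eser u = (1 :: ('v, 'a::comm_ring_1) mvps)"
proof (rule mvps_eqI)
  fix m :: "'v multiset"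
  have "mcoeff (hser u * eser u) m =
      (\<Sum>S\<in>Pow (set_mset m). u ^ size m * ((\<Prod>x\<in>S. - 1) * (\<Prod>x\<in>set_mset m - S. 1)))"
    unfolding mcoeff_mult_eser
  proof (rule sum.cong[OF refl])
    fix S assume "S \<in> Pow (set_mset m)"
    hence "mset_set S \<subseteq># m" by (auto simp: mset_set_subseteq_iff finite_subset)
    hence "size m = size (m - mset_set S) + card S"
      by (metis size_mset_set size_union subset_mset.diff_add)
    thus "mcoeff (hser u) (m - mset_set S) * (- u) ^ card S =
        u ^ size m * ((\<Prod>x\<in>S. - 1) * (\<Prod>x\<in>set_mset m - S. 1))"
      by (simp add: hser_def power_add power_minus[of u])
  qed
  also have "\<dots> = u ^ size m * (\<Prod>x\<in>set_mset m. - 1 + 1)"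
    by (subst prod_add) (simp_all add: sum_distrib_left)
  also have "\<dots> = mcoeff 1 m"
    by (auto simp: mcoeff_one power_0_left)
  finally show "mcoeff (hser u * eser u) m = mcoeff 1 m" .
qed

section \<open>Diagonal coefficients of products of series\<close>

definition diagonal_ser :: "('v \<Rightarrow> ('v, 'a::comm_ring_1) mvps) \<Rightarrow> ('v, 'a) mvps" where
  "diagonal_ser L = Abs_mvps (\<lambda>m. mcoeff (\<Prod>v\<in>#m. L v) m)"

definition repeats :: "'v multiset \<Rightarrow> 'v multiset" where
  "repeats m = m - mset_set (set_mset m)"

lemma repeats_add_mset:
  "repeats (add_mset v m) = (if v \<in># m then add_mset v (repeats m) else repeats m)"
  using multiset_diff_union_assoc[OF mset_set_set_mset_msubset, of "{#v#}" m]
  by (simp add: repeats_def insert_absorb)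

lemma diff_mset_set_eq_repeats:
  assumes "S \<subseteq> set_mset m"
  shows "m - mset_set S = mset_set (set_mset m - S) + repeats m"
proof -
  have "mset_set (set_mset m) = mset_set S + mset_set (set_mset m - S)"
    using assms by (metis finite_set_mset mset_set_Diff mset_set_set_mset_msubset
        subset_imp_msubset_mset_set subset_mset.add_diff_inverse)
  moreover have "mset_set (set_mset m) + repeats m = m"
    unfolding repeats_def by (simp add: mset_set_set_mset_msubset)
  ultimately show ?thesis by (metis add.assoc add_diff_cancel_left')
qed

lemma mcoeff_diagonal_ser_mult_eser:
  "mcoeff (diagonal_ser L * eser u) m =
    mcoeff ((\<Prod>v\<in>set_mset m. L v - mmonom u {#v#}) * (\<Prod>v\<in>#repeats m. L v)) m"
proof -
  let ?T = "set_mset m" and ?R = "\<Prod>v\<in>#repeats m. L v"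
  have "(\<Prod>v\<in>?T. L v - mmonom u {#v#}) = (\<Prod>v\<in>?T. mmonom (- u) {#v#} + L v)"
    by (intro prod.cong refl mvps_eqI) (simp add: mcoeff_mmonom)
  hence "(\<Prod>v\<in>?T. L v - mmonom u {#v#}) * ?R =
      (\<Sum>S\<in>Pow ?T. (\<Prod>v\<in>S. mmonom (- u) {#v#}) * (\<Prod>v\<in>?T - S. L v) * ?R)"
    by (simp add: prod_add sum_distrib_right)
  also have "\<dots> = (\<Sum>S\<in>Pow ?T. mmonom ((- u) ^ card S) (mset_set S) * (\<Prod>v\<in>#m - mset_set S. L v))"
    by (intro sum.cong refl)
      (auto simp: prod_mmonom diff_mset_set_eq_repeats prod_unfold_prod_mset mult.assoc
        sum_unfold_sum_mset)
  finally have "mcoeff ((\<Prod>v\<in>?T. L v - mmonom u {#v#}) * ?R) m =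
      (\<Sum>S\<in>Pow ?T. mcoeff (mmonom ((- u) ^ card S) (mset_set S) * (\<Prod>v\<in>#m - mset_set S. L v)) m)"
    by simp
  also have "\<dots> = (\<Sum>S\<in>Pow ?T. mcoeff (diagonal_ser L) (m - mset_set S) * (- u) ^ card S)"
    by (intro sum.cong refl)
      (auto simp: mcoeff_mmonom_mult mset_set_subseteq_iff finite_subset diagonal_ser_def)
  finally show ?thesis by (simp add: mcoeff_mult_eser)
qed

text \<open>
  If \<open>v\<^sub>1 < \<dots> < v\<^sub>r\<close> are the elements of \<open>T\<close>, the strict upper set of \<open>v\<^sub>i\<close> is the weak upper
  set of \<open>v\<^sub>i\<^sub>+\<^sub>1\<close>, so the two products share all factors but one.
  The second form cannot be had from the first by cancellation, as \<open>\<phi> {}\<close> may be a zero divisor.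
\<close>

lemma prod_upper_sets_telescope:
  fixes \<phi> :: "'v::linorder set \<Rightarrow> 'r::comm_semiring_1"
  assumes "finite T"
  shows "\<phi> T * (\<Prod>v\<in>T. \<phi> {k\<in>T. v < k}) = \<phi> {} * (\<Prod>v\<in>T. \<phi> {k\<in>T. v \<le> k})"
    and "T \<noteq> {} \<Longrightarrow> \<phi> T = c * \<phi> {} \<Longrightarrow>
      (\<Prod>v\<in>T. \<phi> {k\<in>T. v \<le> k}) = c * (\<Prod>v\<in>T. \<phi> {k\<in>T. v < k})"
  using assms
proof (induction T rule: finite_linorder_min_induct)
  case empty
  {
    case 1
    show ?case by simp
  next
    case 2
    thus ?case by simp
  }
next
  case (insert b A)
  have "b \<notin> A" using insert.hyps by auto
  have "{k \<in> insert b A. v \<le> k} = {k \<in> A. v \<le> k}" "{k \<in> insert b A. v < k} = {k \<in> A. v < k}"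
    if "v \<in> A" for v using insert.hyps that by auto
  moreover have "{k \<in> insert b A. b \<le> k} = insert b A" "{k \<in> insert b A. b < k} = A"
    using insert.hyps by auto
  ultimately have weak: "(\<Prod>v\<in>insert b A. \<phi> {k\<in>insert b A. v \<le> k}) =
        \<phi> (insert b A) * (\<Prod>v\<in>A. \<phi> {k\<in>A. v \<le> k})"
    and strict: "(\<Prod>v\<in>insert b A. \<phi> {k\<in>insert b A. v < k}) = \<phi> A * (\<Prod>v\<in>A. \<phi> {k\<in>A. v < k})"
    using insert.hyps(1) \<open>b \<notin> A\<close> by simp_all
  {
    case 1
    show ?case unfolding weak strict insert.IH(1) by (rule mult.left_commute)
  next
    case 2
    show ?case unfolding weak strict insert.IH(1) 2 by (rule mult.assoc)
  }
qed

section \<open>The generating series of barred words\<close>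

text \<open>
  The coefficient of \<open>y\<^sub>k\<close> counts the ways in which a value lying in the block of \<open>v\<close>, but not its
  first element, can occur in the block of \<open>k\<close>: as a barred letter (weight \<open>t\<close>) or as a plain one
  (weight 1).  Blocks of larger letters come first, since words are weakly decreasing.
\<close>

definition exd_form :: "'a::comm_ring_1 \<Rightarrow> 'v::linorder set \<Rightarrow> 'v \<Rightarrow> ('v, 'a) mvps" where
  "exd_form t T v = mconst t * var_sum {k\<in>T. v \<le> k} + var_sum {k\<in>T. k \<le> v}"

lemma exd_form_diff_var:
  fixes t :: "'a::comm_ring_1" and T :: "'v::linorder set"
  assumes "v \<in> T"
  shows "exd_form t T v - mmonom t {#v#} = mconst t * var_sum {k\<in>T. v < k} + var_sum {k\<in>T. k \<le> v}"
    and "exd_form t T v - mmonom 1 {#v#} = mconst t * var_sum {k\<in>T. v \<le> k} + var_sum {k\<in>T. k < v}"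
proof -
  have "{k\<in>T. v \<le> k} = insert v {k\<in>T. v < k}" "{k\<in>T. k \<le> v} = insert v {k\<in>T. k < v}"
    using assms by auto
  hence "var_sum {k\<in>T. v \<le> k} = mmonom (1::'a) {#v#} + var_sum {k\<in>T. v < k}"
    and "var_sum {k\<in>T. k \<le> v} = mmonom (1::'a) {#v#} + var_sum {k\<in>T. k < v}"
    by (simp_all add: var_sum_insert)
  thus "exd_form t T v - mmonom t {#v#} = mconst t * var_sum {k\<in>T. v < k} + var_sum {k\<in>T. k \<le> v}"
    and "exd_form t T v - mmonom 1 {#v#} = mconst t * var_sum {k\<in>T. v \<le> k} + var_sum {k\<in>T. k < v}"
    by (simp_all add: exd_form_def distrib_left mmonom_mult)
qed

lemma prod_exd_form_diff_var:
  fixes t :: "'a::comm_ring_1" and T :: "'v::linorder set"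
  assumes "finite T" "T \<noteq> {}"
  shows "(\<Prod>v\<in>T. exd_form t T v - mmonom 1 {#v#}) =
    mconst t * (\<Prod>v\<in>T. exd_form t T v - mmonom t {#v#})"
proof -
  define \<phi> :: "'v set \<Rightarrow> ('v, 'a) mvps" where "\<phi> U = mconst t * var_sum U + var_sum (T - U)" for U
  have "T - {k\<in>T. v \<le> k} = {k\<in>T. k < v}" "T - {k\<in>T. v < k} = {k\<in>T. k \<le> v}" for v
    by auto
  hence "\<phi> {k\<in>T. v \<le> k} = exd_form t T v - mmonom 1 {#v#}"
    and "\<phi> {k\<in>T. v < k} = exd_form t T v - mmonom t {#v#}" if "v \<in> T" for v
    using that by (simp_all add: \<phi>_def exd_form_diff_var)
  moreover have "var_sum {} = (0 :: ('v, 'a) mvps)"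
    by (rule mvps_eqI) (simp add: mcoeff_var_sum)
  hence "\<phi> T = mconst t * \<phi> {}"
    by (simp add: \<phi>_def)
  ultimately show ?thesis
    using prod_upper_sets_telescope(2)[OF assms, of \<phi> "mconst t"] by simp
qed

lemma restrict_vars_exd_form: "restrict_vars V (exd_form t T v) = exd_form t (T \<inter> V) v"
proof -
  have "{k\<in>T. v \<le> k} \<inter> V = {k \<in> T \<inter> V. v \<le> k}" "{k\<in>T. k \<le> v} \<inter> V = {k \<in> T \<inter> V. k \<le> v}"
    by auto
  thus ?thesis
    by (simp add: exd_form_def restrict_vars_add restrict_vars_mult restrict_vars_mmonom
        restrict_vars_var_sum)
qed

definition exd_ser :: "'a::comm_ring_1 \<Rightarrow> ('v::linorder, 'a) mvps" where
  "exd_ser t = diagonal_ser (exd_form t UNIV)"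

lemma mcoeff_exd_ser_mult_eser:
  fixes t u :: "'a::comm_ring_1" and m :: "'v::linorder multiset"
  defines "L \<equiv> exd_form t (set_mset m)"
  shows "mcoeff (exd_ser t * eser u) m =
    mcoeff ((\<Prod>v\<in>set_mset m. L v - mmonom u {#v#}) * (\<Prod>v\<in>#repeats m. L v)) m"
proof -
  let ?L = "exd_form t (UNIV :: 'v set)" and ?restrict = "restrict_vars (set_mset m)"
  have restrict_L: "?restrict (?L v) = L v" for v
    by (simp add: restrict_vars_exd_form L_def)
  have "mcoeff (exd_ser t * eser u) m =
      mcoeff (?restrict ((\<Prod>v\<in>set_mset m. ?L v - mmonom u {#v#}) * (\<Prod>v\<in>#repeats m. ?L v))) m"
    by (simp add: exd_ser_def mcoeff_diagonal_ser_mult_eser mcoeff_restrict_vars)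
  also have "?restrict ((\<Prod>v\<in>set_mset m. ?L v - mmonom u {#v#}) * (\<Prod>v\<in>#repeats m. ?L v)) =
      (\<Prod>v\<in>set_mset m. L v - mmonom u {#v#}) * (\<Prod>v\<in>#repeats m. L v)"
    by (simp add: restrict_vars_mult restrict_vars_prod restrict_vars_prod_mset restrict_vars_diff
        restrict_vars_mmonom restrict_L)
  finally show ?thesis .
qed

lemma exd_ser_mult_eser_diff: "exd_ser t * (eser 1 - mconst t * eser t) = 1 - mconst t"
proof (rule mvps_eqI)
  fix m :: "'a multiset"
  have "exd_ser t * (eser 1 - mconst t * eser t) =
      exd_ser t * eser 1 - mconst t * (exd_ser t * eser t :: ('a, 'b) mvps)"
    by (simp add: algebra_simps)
  hence "mcoeff (exd_ser t * (eser 1 - mconst t * eser t)) m =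
     mcoeff (exd_ser t * eser 1) m - t * mcoeff (exd_ser t * eser t) m"
    by (simp add: mcoeff_mconst_mult)
  also have "\<dots> = mcoeff (1 - mconst t) m"
  proof (cases "m = {#}")
    case True
    thus ?thesis by (simp add: mcoeff_exd_ser_mult_eser repeats_def mcoeff_mmonom mcoeff_one)
  next
    case False
    thus ?thesis
      by (simp add: mcoeff_exd_ser_mult_eser prod_exd_form_diff_var mult.assoc mcoeff_mconst_mult
          mcoeff_mmonom mcoeff_one)
  qed
  finally show "mcoeff (exd_ser t * (eser 1 - mconst t * eser t)) m = mcoeff (1 - mconst t) m" .
qed

lemma exd_ser_mult_eser_hser:
  "exd_ser t * eser t * (hser t - mconst t * hser 1) = (1 - mconst t) * hser 1"
proof -
  have "exd_ser t * eser t * (hser t - mconst t * hser 1) =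
      exd_ser t * (hser t * eser t) - exd_ser t * mconst t * eser t * hser 1"
    by (simp add: algebra_simps)
  also have "hser t * eser t = hser 1 * eser 1"
    by (simp add: hser_mult_eser)
  also have "exd_ser t * (hser 1 * eser 1) - exd_ser t * mconst t * eser t * hser 1 =
      exd_ser t * (eser 1 - mconst t * eser t) * hser 1"
    by (simp add: algebra_simps)
  finally show ?thesis by (simp add: exd_ser_mult_eser_diff)
qed

lemma hser_diff_dvd_one:
  fixes t :: "'a::comm_ring_1"
  assumes "1 - t dvd 1"
  shows "(hser t - mconst t * hser 1 :: ('v::linorder, 'a) mvps) dvd 1" (is "?d dvd 1")
proof -
  have "mconst (1 - t) = (1 - mconst t :: ('v, 'a) mvps)"
    by (rule mvps_eqI) (simp add: mcoeff_mmonom mcoeff_one)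
  hence "(1 - mconst t :: ('v, 'a) mvps) dvd 1"
    using mconst_dvd_one[OF assms, where 'v = 'v] by simp
  moreover have "(hser 1 :: ('v, 'a) mvps) dvd 1"
    by (rule dvdI[of _ _ "eser 1"]) (simp add: hser_mult_eser)
  ultimately have "(1 - mconst t) * hser 1 dvd (1 * 1 :: ('v, 'a) mvps)"
    by (rule mult_dvd_mono)
  hence "exd_ser t * eser t * ?d dvd 1"
    by (simp only: exd_ser_mult_eser_hser mult_1)
  thus ?thesis
    by (rule dvd_trans[OF dvd_triv_right])
qed

section \<open>Sorting permutations\<close>

lemma strict_antimono_on_atLeastAtMost_iff:
  fixes f :: "nat \<Rightarrow> 'a::order"
  shows "strict_antimono_on {m..n} f \<longleftrightarrow> (\<forall>i\<in>{m..<n}. f (Suc i) < f i)"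
proof
  assume "strict_antimono_on {m..n} f"
  thus "\<forall>i\<in>{m..<n}. f (Suc i) < f i" by (auto simp: monotone_on_def)
next
  assume adjacent: "\<forall>i\<in>{m..<n}. f (Suc i) < f i"
  show "strict_antimono_on {m..n} f"
  proof (rule monotone_onI)
    fix i j assume "i \<in> {m..n}" "j \<in> {m..n}" "i < j"
    hence "Suc i \<le> j" "m \<le> i" "j \<le> n" by auto
    thus "f j < f i"
    proof (induction j rule: dec_induct)
      case base
      thus ?case using adjacent by simp
    next
      case (step j)
      hence "f (Suc j) < f j" using adjacent by simp
      also have "f j < f i" using step by simp
      finally show ?case .
    qed
  qed
qed

lemma strict_mono_on_less_image:
  fixes f :: "nat \<Rightarrow> nat"
  assumes "strict_mono_on {a..b} f" "a < f a" "a \<le> i" "i \<le> b"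
  shows "i < f i"
  using assms(3,4)
proof (induction i rule: dec_induct)
  case base
  show ?case by fact
next
  case (step i)
  hence "f i < f (Suc i)" using assms(1) by (simp add: monotone_on_def)
  thus ?case using step by simp
qed

lemma strict_mono_on_image_le:
  fixes f :: "nat \<Rightarrow> nat"
  assumes "strict_mono_on {a..b} f" "f b \<le> b" "a \<le> i" "i \<le> b"
  shows "f i \<le> i"
  using assms(4,3)
proof (induction i rule: inc_induct)
  case base
  show ?case by fact
next
  case (step i)
  hence "f i < f (Suc i)" using assms(1) by (simp add: monotone_on_def)
  thus ?case using step by simp
qed

lemma antimono_on_eq_if_image_mset_eq:
  fixes f h :: "nat \<Rightarrow> 'a::linorder"
  assumes "antimono_on {m..n} f" "antimono_on {m..n} h"
    and "image_mset f (mset_set {m..n}) = image_mset h (mset_set {m..n})"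
    and "i \<in> {m..n}"
  shows "f i = h i"
proof -
  have sorted: "sorted (rev (map g [m..<Suc n]))" if "antimono_on {m..n} g" for g :: "nat \<Rightarrow> 'a"
    using that by (auto simp: sorted_rev_iff_nth_mono simp del: upt_Suc intro: monotone_onD)
  have "mset (rev (map f [m..<Suc n])) = mset (rev (map h [m..<Suc n]))"
    using assms(3) by (simp add: atLeastLessThanSuc_atLeastAtMost del: upt_Suc)
  hence "rev (map f [m..<Suc n]) = rev (map h [m..<Suc n])"
    using sorted[OF assms(1)] sorted[OF assms(2)] by (metis properties_for_sort)
  thus ?thesis using assms(4) by (auto simp del: upt_Suc)
qed

definition sort_rank :: "(nat \<Rightarrow> 'k::linorder) \<Rightarrow> nat \<Rightarrow> nat \<Rightarrow> nat" where
  "sort_rank key n v = card {u\<in>{1..n}. key v \<le> key u}"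

lemma sort_rank_less:
  assumes "v \<in> {1..n}" "key v < key u"
  shows "sort_rank key n u < sort_rank key n v"
proof -
  have "v \<in> {w\<in>{1..n}. key v \<le> key w}" "v \<notin> {w\<in>{1..n}. key u \<le> key w}"
    using assms by auto
  moreover have "{w\<in>{1..n}. key u \<le> key w} \<subseteq> {w\<in>{1..n}. key v \<le> key w}"
    using assms by force
  ultimately show ?thesis
    unfolding sort_rank_def by (intro psubset_card_mono) auto
qed

lemma bij_betw_sort_rank:
  assumes "inj_on key {1..n}"
  shows "bij_betw (sort_rank key n) {1..n} {1..n}"
proof -
  have inj: "inj_on (sort_rank key n) {1..n}"
  proof (rule inj_onI)
    fix u v assume uv: "u \<in> {1..n}" "v \<in> {1..n}" "sort_rank key n u = sort_rank key n v"
    hence "key u = key v"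
      using sort_rank_less[of u n key v] sort_rank_less[of v n key u] by fastforce
    thus "u = v" using assms uv by (auto dest: inj_onD)
  qed
  have "sort_rank key n v \<in> {1..n}" if "v \<in> {1..n}" for v
  proof -
    have "v \<in> {u\<in>{1..n}. key v \<le> key u}" using that by simp
    hence "sort_rank key n v > 0" unfolding sort_rank_def by (auto simp: card_gt_0_iff)
    moreover have "sort_rank key n v \<le> card {1..n}"
      unfolding sort_rank_def by (intro card_mono) auto
    ultimately show ?thesis by simp
  qed
  hence "sort_rank key n ` {1..n} \<subseteq> {1..n}" by (rule image_subsetI)
  thus ?thesis unfolding bij_betw_def using inj endo_inj_surj[OF finite_atLeastAtMost] by blast
qed

lemma sort_rank_sorting_permutation:
  assumes \<sigma>: "\<sigma> permutes {1..n}" and anti: "strict_antimono_on {1..n} (key \<circ> \<sigma>)"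
    and i: "i \<in> {1..n}"
  shows "sort_rank key n (\<sigma> i) = i"
proof -
  have key_le_iff: "key (\<sigma> i) \<le> key (\<sigma> j) \<longleftrightarrow> j \<le> i" if "j \<in> {1..n}" for j
    using monotone_onD[OF anti i that] monotone_onD[OF anti that i]
    by (cases i j rule: linorder_cases) auto
  have "{v\<in>{1..n}. key (\<sigma> i) \<le> key v} = {v\<in>\<sigma> ` {1..n}. key (\<sigma> i) \<le> key v}"
    using \<sigma> by (simp add: permutes_image)
  also have "\<dots> = \<sigma> ` {1..i}"
    using i key_le_iff by auto
  finally show ?thesis
    using \<sigma> by (simp add: sort_rank_def card_image permutes_inj_on)
qed

lemma sorting_permutation_unique:
  fixes key :: "nat \<Rightarrow> 'k::linorder"
  assumes "\<sigma> permutes {1..n}" "strict_antimono_on {1..n} (key \<circ> \<sigma>)"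
    and "\<tau> permutes {1..n}" "strict_antimono_on {1..n} (key \<circ> \<tau>)"
  shows "\<sigma> = \<tau>"
proof
  fix i
  show "\<sigma> i = \<tau> i"
  proof (cases "i \<in> {1..n}")
    case True
    hence "\<sigma> i \<in> \<tau> ` {1..n}"
      by (simp only: permutes_in_image[OF assms(1)] permutes_image[OF assms(3)])
    then obtain j where "j \<in> {1..n}" "\<sigma> i = \<tau> j" by blast
    hence "i = j"
      using True sort_rank_sorting_permutation[OF assms(1,2)]
        sort_rank_sorting_permutation[OF assms(3,4)] by metis
    thus ?thesis using \<open>\<sigma> i = \<tau> j\<close> by simp
  next
    case False
    thus ?thesis using assms(1,3) by (simp add: permutes_not_in)
  qed
qed

lemma ex_sorting_permutation:
  fixes key :: "nat \<Rightarrow> 'k::linorder"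
  assumes "inj_on key {1..n}"
  obtains \<sigma> where "\<sigma> permutes {1..n}" "strict_antimono_on {1..n} (key \<circ> \<sigma>)"
proof -
  let ?rank = "sort_rank key n"
  note bij = bij_betw_sort_rank[OF assms]
  define \<sigma> where "\<sigma> i = (if i \<in> {1..n} then inv_into {1..n} ?rank i else i)" for i
  have "bij_betw \<sigma> {1..n} {1..n} \<longleftrightarrow> bij_betw (inv_into {1..n} ?rank) {1..n} {1..n}"
    by (rule bij_betw_cong) (simp add: \<sigma>_def)
  hence perm: "\<sigma> permutes {1..n}"
    using bij_betw_inv_into[OF bij] by (intro bij_imp_permutes) (auto simp: \<sigma>_def)
  have rank: "?rank (\<sigma> i) = i" if "i \<in> {1..n}" for i
    using that bij by (auto simp: \<sigma>_def bij_betw_inv_into_right)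
  have "key (\<sigma> j) < key (\<sigma> i)" if ij: "i \<in> {1..n}" "j \<in> {1..n}" "i < j" for i j
  proof -
    have mem: "\<sigma> i \<in> {1..n}" "\<sigma> j \<in> {1..n}"
      using ij by (simp_all only: permutes_in_image[OF perm])
    have "\<not> key (\<sigma> i) < key (\<sigma> j)"
    proof
      assume "key (\<sigma> i) < key (\<sigma> j)"
      with mem(1) have "?rank (\<sigma> j) < ?rank (\<sigma> i)" by (rule sort_rank_less)
      thus False using ij by (simp add: rank)
    qed
    moreover have "\<sigma> i \<noteq> \<sigma> j" using ij rank[of i] rank[of j] by auto
    hence "key (\<sigma> i) \<noteq> key (\<sigma> j)" using assms mem by (auto dest: inj_onD)
    ultimately show ?thesis by simp
  qed
  hence "strict_antimono_on {1..n} (key \<circ> \<sigma>)" by (simp add: monotone_on_def)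
  with perm show thesis by (rule that)
qed

section \<open>Codes of permutations with prescribed excedance-descent set\<close>

text \<open>Here \<open>b i\<close> is the letter at position \<open>i\<close> of a word of length \<open>n\<close>, and a block is a fibre of \<open>b\<close>.\<close>

definition exd_perms :: "(nat \<Rightarrow> 'v::linorder) \<Rightarrow> nat \<Rightarrow> (nat \<Rightarrow> nat) set" where
  "exd_perms b n = {\<sigma>. \<sigma> permutes {1..n} \<and> (\<forall>j\<in>EXD n \<sigma>. b (Suc j) < b j)}"

definition value_code :: "(nat \<Rightarrow> 'v) \<Rightarrow> nat \<Rightarrow> (nat \<Rightarrow> nat) \<Rightarrow> nat \<Rightarrow> 'v \<times> bool" where
  "value_code b n \<sigma> = (\<lambda>v\<in>{1..n}. (b (inv \<sigma> v), inv \<sigma> v < v))"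

text \<open>
  A barred value \<open>p\<close> may be put into the block of \<open>k\<close> iff that block has a position before \<open>p\<close>, a
  plain one iff it has a position at or after \<open>p\<close>; since barred letters come first and each kind
  increases along a block, this already forces every barred letter to be an excedance and every
  plain one not to be.
\<close>

definition choices :: "(nat \<Rightarrow> 'v) \<Rightarrow> nat \<Rightarrow> nat \<Rightarrow> ('v \<times> bool) set" where
  "choices b n p = b ` {1..<p} \<times> {True} \<union> b ` {p..n} \<times> {False}"

definition exd_codes :: "(nat \<Rightarrow> 'v) \<Rightarrow> nat \<Rightarrow> (nat \<Rightarrow> 'v \<times> bool) set" where
  "exd_codes b n = {g \<in> PiE {1..n} (choices b n).
     image_mset (fst \<circ> g) (mset_set {1..n}) = image_mset b (mset_set {1..n})}"

text \<open>
  Sorting the values by decreasing key lists the blocks from the largest letter down, and within a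
  block first the barred and then the plain values, each kind increasingly.
\<close>

definition sort_key :: "(nat \<Rightarrow> 'v \<times> bool) \<Rightarrow> nat \<Rightarrow> 'v \<times> bool \<times> int" where
  "sort_key g v = (fst (g v), snd (g v), - int v)"

lemma inj_sort_key: "inj (sort_key g)"
  by (rule injI) (simp add: sort_key_def)

lemma value_code_apply:
  assumes "\<sigma> permutes {1..n}" "i \<in> {1..n}"
  shows "value_code b n \<sigma> (\<sigma> i) = (b i, i < \<sigma> i)"
  using assms permutes_in_image[OF assms(1), of i]
  by (simp add: value_code_def permutes_inverses)

lemma letter_less_bar_word_iff:
  "letter_less (bar_word \<sigma> j) (bar_word \<sigma> i) \<longleftrightarrow>
     (i < \<sigma> i, - int (\<sigma> i)) < (j < \<sigma> j, - int (\<sigma> j))"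
  by (auto simp: bar_word_def)

lemma exd_perms_iff_sorted:
  assumes anti: "antimono_on {1..n} b" and \<sigma>: "\<sigma> permutes {1..n}"
  shows "\<sigma> \<in> exd_perms b n \<longleftrightarrow> strict_antimono_on {1..n} (sort_key (value_code b n \<sigma>) \<circ> \<sigma>)"
proof -
  let ?key = "sort_key (value_code b n \<sigma>) \<circ> \<sigma>"
  have "(i \<in> EXD n \<sigma> \<longrightarrow> b (Suc i) < b i) \<longleftrightarrow> ?key (Suc i) < ?key i" if i: "i \<in> {1..<n}" for i
  proof -
    have "\<sigma> i \<noteq> \<sigma> (Suc i)" using permutes_inj[OF \<sigma>] by (simp add: inj_eq)
    moreover have "b (Suc i) \<le> b i" using anti i by (simp add: monotone_on_def)
    moreover have "i \<in> EXD n \<sigma> \<longleftrightarrow>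
        (i < \<sigma> i, - int (\<sigma> i)) < (Suc i < \<sigma> (Suc i), - int (\<sigma> (Suc i)))"
      using i by (simp add: EXD_def letter_less_bar_word_iff)
    moreover have "?key i = (b i, i < \<sigma> i, - int (\<sigma> i))"
      "?key (Suc i) = (b (Suc i), Suc i < \<sigma> (Suc i), - int (\<sigma> (Suc i)))"
      using i \<sigma> by (simp_all add: sort_key_def value_code_apply)
    ultimately show ?thesis by auto
  qed
  moreover have "EXD n \<sigma> \<subseteq> {1..<n}" by (auto simp: EXD_def)
  ultimately have "(\<forall>j\<in>EXD n \<sigma>. b (Suc j) < b j) \<longleftrightarrow> (\<forall>i\<in>{1..<n}. ?key (Suc i) < ?key i)"
    by blast
  thus ?thesis
    using \<sigma> unfolding exd_perms_def strict_antimono_on_atLeastAtMost_iff by simp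
qed

lemma value_code_in_exd_codes:
  assumes \<sigma>: "\<sigma> permutes {1..n}"
  shows "value_code b n \<sigma> \<in> exd_codes b n"
proof -
  have inv: "inv \<sigma> permutes {1..n}" using \<sigma> by (rule permutes_inv)
  have "value_code b n \<sigma> v \<in> choices b n v" if "v \<in> {1..n}" for v
  proof -
    have "inv \<sigma> v \<in> {1..n}" using that by (simp only: permutes_in_image[OF inv])
    thus ?thesis using that by (cases "inv \<sigma> v < v") (auto simp: value_code_def choices_def)
  qed
  moreover have "image_mset (fst \<circ> value_code b n \<sigma>) (mset_set {1..n}) =
      image_mset b (image_mset (inv \<sigma>) (mset_set {1..n}))"
    by (auto simp: multiset.map_comp value_code_def intro!: image_mset_cong)
  hence "image_mset (fst \<circ> value_code b n \<sigma>) (mset_set {1..n}) = image_mset b (mset_set {1..n})"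
    by (simp only: permutes_image_mset[OF inv])
  ultimately show ?thesis
    by (auto simp: exd_codes_def value_code_def)
qed

context
  fixes b :: "nat \<Rightarrow> 'v::linorder" and n :: nat and g :: "nat \<Rightarrow> 'v \<times> bool" and \<sigma> :: "nat \<Rightarrow> nat"
  assumes anti: "antimono_on {1..n} b"
    and g: "g \<in> exd_codes b n"
    and \<sigma>: "\<sigma> permutes {1..n}"
    and sorted: "strict_antimono_on {1..n} (sort_key g \<circ> \<sigma>)"
begin

lemma sorted_code_block:
  assumes "i \<in> {1..n}"
  shows "fst (g (\<sigma> i)) = b i"
proof -
  have "antimono_on {1..n} (sort_key g \<circ> \<sigma>)"
    using sorted unfolding strict_antimono_iff_antimono by blast
  hence "sort_key g (\<sigma> k) \<le> sort_key g (\<sigma> j)" if "j \<in> {1..n}" "k \<in> {1..n}" "j \<le> k" for j k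
    using that by (simp add: monotone_on_def)
  hence "antimono_on {1..n} (fst \<circ> g \<circ> \<sigma>)"
    by (intro monotone_onI) (fastforce simp: sort_key_def less_eq_prod_def)
  moreover have "image_mset (fst \<circ> g \<circ> \<sigma>) (mset_set {1..n}) =
      image_mset (fst \<circ> g) (image_mset \<sigma> (mset_set {1..n}))"
    by (simp add: multiset.map_comp)
  hence "image_mset (fst \<circ> g \<circ> \<sigma>) (mset_set {1..n}) = image_mset b (mset_set {1..n})"
    using g by (simp only: permutes_image_mset[OF \<sigma>] exd_codes_def mem_Collect_eq)
  ultimately have "(fst \<circ> g \<circ> \<sigma>) i = b i"
    using antimono_on_eq_if_image_mset_eq anti assms by blast
  thus ?thesis by simp
qed

lemma sorted_code_choice:
  assumes "i \<in> {1..n}"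
  obtains j where "j \<in> {1..n}" "b j = b i" "snd (g (\<sigma> i)) \<longleftrightarrow> j < \<sigma> i"
proof -
  have "\<sigma> i \<in> {1..n}" using assms by (simp only: permutes_in_image[OF \<sigma>])
  hence "g (\<sigma> i) \<in> choices b n (\<sigma> i)" using g by (auto simp: exd_codes_def)
  moreover have "g (\<sigma> i) = (b i, snd (g (\<sigma> i)))"
    by (simp add: prod_eq_iff sorted_code_block[OF assms])
  ultimately have "(b i, snd (g (\<sigma> i))) \<in> choices b n (\<sigma> i)" by simp
  hence "\<exists>j\<in>{1..n}. b j = b i \<and> (snd (g (\<sigma> i)) \<longleftrightarrow> j < \<sigma> i)"
    using \<open>\<sigma> i \<in> {1..n}\<close> by (auto simp: choices_def)
  thus thesis using that by blast
qed

lemma sorted_code_barred_first: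
  assumes "i \<in> {1..n}" "j \<in> {1..n}" "i \<le> j" "b i = b j" "snd (g (\<sigma> j))"
  shows "snd (g (\<sigma> i))"
proof (cases "i = j")
  case False
  hence "sort_key g (\<sigma> j) < sort_key g (\<sigma> i)"
    using monotone_onD[OF sorted assms(1,2)] assms(3) by simp
  thus ?thesis using assms by (auto simp: sort_key_def sorted_code_block)
qed (use assms in simp)

lemma sorted_code_less:
  assumes "i \<in> {1..n}" "j \<in> {1..n}" "i < j" "b i = b j" "snd (g (\<sigma> i)) = snd (g (\<sigma> j))"
  shows "\<sigma> i < \<sigma> j"
  using monotone_onD[OF sorted assms(1-3)] assms by (auto simp: sort_key_def sorted_code_block)

lemma sorted_code_strict_mono:
  assumes a: "a \<in> {1..n}" and c: "c \<in> {1..n}"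
    and "b a = b c" "snd (g (\<sigma> a)) = snd (g (\<sigma> c))"
  shows "strict_mono_on {a..c} \<sigma>"
proof -
  have between: "j \<in> {1..n} \<and> b j = b c \<and> snd (g (\<sigma> j)) = snd (g (\<sigma> c))" if "j \<in> {a..c}" for j
  proof (intro conjI)
    show j: "j \<in> {1..n}" using a c that by simp
    show block: "b j = b c"
      using monotone_onD[OF anti a j] monotone_onD[OF anti j c] that assms(3) by simp
    show "snd (g (\<sigma> j)) = snd (g (\<sigma> c))"
      using sorted_code_barred_first[OF a j] sorted_code_barred_first[OF j c _ block]
        that block assms(3,4)
      by fastforce
  qed
  show ?thesis
  proof (rule strict_mono_onI)
    fix j k assume "j \<in> {a..c}" "k \<in> {a..c}" "j < k"
    thus "\<sigma> j < \<sigma> k"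
      using between[of j] between[of k] by (intro sorted_code_less) simp_all
  qed
qed

lemma sorted_code_barred:
  assumes i: "i \<in> {1..n}" and barred: "snd (g (\<sigma> i))"
  shows "i < \<sigma> i"
proof -
  let ?B = "{j\<in>{1..n}. b j = b i}"
  define a where "a = Min ?B"
  have "a \<in> ?B" unfolding a_def by (rule Min_in) (use i in auto)
  hence a: "a \<in> {1..n}" "b a = b i" by auto
  have a_le: "a \<le> j" if "j \<in> ?B" for j
    unfolding a_def using that by (intro Min_le) auto
  hence "a \<le> i" using i by simp
  hence "snd (g (\<sigma> a))"
    using sorted_code_barred_first[OF a(1) i _ a(2)] barred by simp
  moreover obtain j where "j \<in> {1..n}" "b j = b a" "snd (g (\<sigma> a)) \<longleftrightarrow> j < \<sigma> a"
    using sorted_code_choice[OF a(1)] .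
  ultimately have "a < \<sigma> a" using a_le[of j] a(2) by simp
  moreover have "strict_mono_on {a..i} \<sigma>"
    using \<open>snd (g (\<sigma> a))\<close> barred by (intro sorted_code_strict_mono[OF a(1) i a(2)]) simp
  ultimately show ?thesis
    using \<open>a \<le> i\<close> by (intro strict_mono_on_less_image[of a i \<sigma> i]) auto
qed

lemma sorted_code_plain:
  assumes i: "i \<in> {1..n}" and plain: "\<not> snd (g (\<sigma> i))"
  shows "\<sigma> i \<le> i"
proof -
  let ?B = "{j\<in>{1..n}. b j = b i}"
  define c where "c = Max ?B"
  have "c \<in> ?B" unfolding c_def by (rule Max_in) (use i in auto)
  hence c: "c \<in> {1..n}" "b i = b c" by auto
  have le_c: "j \<le> c" if "j \<in> ?B" for j
    unfolding c_def using that by (intro Max_ge) auto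
  hence "i \<le> c" using i by simp
  hence "\<not> snd (g (\<sigma> c))"
    using sorted_code_barred_first[OF i c(1) _ c(2)] plain by blast
  moreover obtain j where "j \<in> {1..n}" "b j = b c" "snd (g (\<sigma> c)) \<longleftrightarrow> j < \<sigma> c"
    using sorted_code_choice[OF c(1)] .
  ultimately have "\<sigma> c \<le> c" using le_c[of j] c(2) by simp
  moreover have "strict_mono_on {i..c} \<sigma>"
    using \<open>\<not> snd (g (\<sigma> c))\<close> plain by (intro sorted_code_strict_mono[OF i c]) simp
  ultimately show ?thesis
    using \<open>i \<le> c\<close> by (intro strict_mono_on_image_le[of i c \<sigma> i]) auto
qed

lemma value_code_sorting: "value_code b n \<sigma> = g"
proof
  fix v
  show "value_code b n \<sigma> v = g v"
  proof (cases "v \<in> {1..n}")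
    case True
    then obtain i where i: "i \<in> {1..n}" "v = \<sigma> i"
      using permutes_image[OF \<sigma>] by blast
    moreover have "snd (g (\<sigma> i)) \<longleftrightarrow> i < \<sigma> i"
      using sorted_code_barred[OF i(1)] sorted_code_plain[OF i(1)] by linarith
    ultimately show ?thesis
      by (simp add: value_code_apply[OF \<sigma>] prod_eq_iff sorted_code_block)
  next
    case False
    thus ?thesis using g by (auto simp: value_code_def exd_codes_def PiE_def extensional_def)
  qed
qed

end

lemma bij_betw_value_code:
  assumes anti: "antimono_on {1..n} b"
  shows "bij_betw (value_code b n) (exd_perms b n) (exd_codes b n)"
  unfolding bij_betw_def
proof (intro conjI equalityI subsetI)
  have perm: "\<sigma> permutes {1..n}" if "\<sigma> \<in> exd_perms b n" for \<sigma>
    using that by (simp add: exd_perms_def)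
  show "inj_on (value_code b n) (exd_perms b n)"
    by (rule inj_onI) (metis anti exd_perms_iff_sorted perm sorting_permutation_unique)
  show "g \<in> exd_codes b n" if "g \<in> value_code b n ` exd_perms b n" for g
    using that perm value_code_in_exd_codes by auto
  fix g assume g: "g \<in> exd_codes b n"
  obtain \<sigma> where \<sigma>: "\<sigma> permutes {1..n}" "strict_antimono_on {1..n} (sort_key g \<circ> \<sigma>)"
    by (rule ex_sorting_permutation) (rule inj_on_subset[OF inj_sort_key subset_UNIV])
  hence "value_code b n \<sigma> = g"
    using value_code_sorting[OF anti g] by blast
  moreover from this have "\<sigma> \<in> exd_perms b n"
    using \<sigma> by (simp add: exd_perms_iff_sorted[OF anti])
  ultimately show "g \<in> value_code b n ` exd_perms b n" by blast
qed

lemma card_value_code_barred: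
  assumes \<sigma>: "\<sigma> permutes {1..n}"
  shows "card {v \<in> {1..n}. snd (value_code b n \<sigma> v)} = exc n \<sigma>"
proof -
  have bar: "snd (value_code b n \<sigma> (\<sigma> i)) \<longleftrightarrow> i < \<sigma> i" if "i \<in> {1..n}" for i
    by (simp add: value_code_apply[OF \<sigma> that])
  have "{v \<in> {1..n}. snd (value_code b n \<sigma> v)} = {v \<in> \<sigma> ` {1..n}. snd (value_code b n \<sigma> v)}"
    by (simp only: permutes_image[OF \<sigma>])
  also have "\<dots> = \<sigma> ` {i \<in> {1..n}. i < \<sigma> i}"
    using bar by auto
  also have "{i \<in> {1..n}. i < \<sigma> i} = {i \<in> {1..<n}. i < \<sigma> i}"
    using permutes_in_image[OF \<sigma>, of n] by (force simp: le_less)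
  finally show ?thesis
    using \<sigma> by (simp add: exc_def card_image permutes_inj_on)
qed

section \<open>Counting codes by excedances\<close>

definition choice_term :: "'a::comm_ring_1 \<Rightarrow> 'v \<times> bool \<Rightarrow> ('v, 'a) mvps" where
  "choice_term t c = mmonom (if snd c then t else 1) {#fst c#}"

lemma finite_choices: "finite (choices b n p)"
  by (simp add: choices_def)

lemma prod_choice_term:
  assumes "finite A"
  shows "(\<Prod>p\<in>A. choice_term t (g p)) =
    mmonom (t ^ card {p\<in>A. snd (g p)}) (image_mset (fst \<circ> g) (mset_set A))"
proof -
  have "(\<Prod>p\<in>A. if snd (g p) then t else 1) = t ^ card {p\<in>A. snd (g p)}"
    using assms by (subst prod.inter_filter[symmetric]) simp_all
  moreover have "(\<Sum>p\<in>A. {#fst (g p)#}) = image_mset (fst \<circ> g) (mset_set A)"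
    using assms by induction simp_all
  ultimately show ?thesis by (simp add: choice_term_def prod_mmonom)
qed

lemma sum_exd_perms_eq_mcoeff_choices:
  fixes t :: "'a::comm_ring_1"
  assumes "antimono_on {1..n} b"
  shows "(\<Sum>\<sigma>\<in>exd_perms b n. t ^ exc n \<sigma>) =
    mcoeff (\<Prod>p\<in>{1..n}. \<Sum>c\<in>choices b n p. choice_term t c) (image_mset b (mset_set {1..n}))"
proof -
  let ?I = "{1..n}"
  let ?m = "image_mset b (mset_set ?I)"
  have "(\<Prod>p\<in>?I. \<Sum>c\<in>choices b n p. choice_term t c) =
      (\<Sum>g\<in>PiE ?I (choices b n). \<Prod>p\<in>?I. choice_term t (g p))"
    by (rule prod_sum_PiE) (simp_all add: finite_choices)
  hence "mcoeff (\<Prod>p\<in>?I. \<Sum>c\<in>choices b n p. choice_term t c) ?m =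
      (\<Sum>g\<in>PiE ?I (choices b n). if image_mset (fst \<circ> g) (mset_set ?I) = ?m
         then t ^ card {v \<in> ?I. snd (g v)} else 0)"
    by (simp only: prod_choice_term[OF finite_atLeastAtMost] mcoeff_sum mcoeff_mmonom
        eq_commute[of ?m])
  also have "\<dots> = (\<Sum>g\<in>exd_codes b n. t ^ card {v \<in> ?I. snd (g v)})"
    unfolding exd_codes_def
    by (rule sum.inter_filter[symmetric]) (intro finite_PiE finite_choices finite_atLeastAtMost)
  also have "\<dots> = (\<Sum>\<sigma>\<in>exd_perms b n. t ^ card {v \<in> ?I. snd (value_code b n \<sigma> v)})"
    by (rule sum.reindex_bij_betw[OF bij_betw_value_code[OF assms], symmetric])
  also have "\<dots> = (\<Sum>\<sigma>\<in>exd_perms b n. t ^ exc n \<sigma>)"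
    by (intro sum.cong refl, subst card_value_code_barred) (simp_all add: exd_perms_def)
  finally show ?thesis ..
qed

lemma sum_choice_term:
  "(\<Sum>c\<in>choices b n p. choice_term t c) =
    mconst t * var_sum (b ` {1..<p}) + var_sum (b ` {p..n})"
proof -
  have "(\<Sum>c\<in>choices b n p. choice_term t c) =
      (\<Sum>k\<in>b ` {1..<p}. mmonom t {#k#}) + (\<Sum>k\<in>b ` {p..n}. mmonom 1 {#k#})"
    unfolding choices_def
    by (subst sum.union_disjoint) (auto simp: choice_term_def sum.cartesian_product')
  thus ?thesis by (simp add: sum_mmonom_singleton mconst_one)
qed

lemma sum_choice_term_eq_exd_form:
  fixes t :: "'a::comm_ring_1" and b :: "nat \<Rightarrow> 'v::linorder"
  assumes anti: "antimono_on {1..n} b" and p: "p \<in> {1..n}"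
  defines "L \<equiv> exd_form t (b ` {1..n})"
  shows "(\<Sum>c\<in>choices b n p. choice_term t c) =
    (if b p \<in> b ` {1..<p} then L (b p) else L (b p) - mmonom t {#b p#})"
proof -
  define T A B where "T = b ` {1..n}" and "A = b ` {1..<p}" and "B = b ` {p..n}"
  have before: "b p \<le> k" if "k \<in> A" for k
    using that monotone_onD[OF anti _ p] p by (auto simp: A_def)
  have after: "k \<le> b p" if "k \<in> B" for k
    using that monotone_onD[OF anti p] p by (auto simp: B_def)
  have T_eq: "T = A \<union> B"
    using p by (auto simp: T_def A_def B_def simp flip: image_Un simp: ivl_disj_un)
  have p_in_B: "b p \<in> B"
    using p by (simp add: B_def)
  have plain: "B = {k\<in>T. k \<le> b p}" and barred: "A - {b p} = {k\<in>T. b p < k}"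
    using before after p_in_B unfolding T_eq by (auto simp: order.strict_iff_order dest: antisym)
  have L_eq: "L = exd_form t T"
    by (simp only: L_def T_def)
  have sum: "(\<Sum>c\<in>choices b n p. choice_term t c) = mconst t * var_sum A + var_sum B"
    by (simp add: sum_choice_term A_def B_def)
  show ?thesis
  proof (cases "b p \<in> A")
    case True
    hence "A = {k\<in>T. b p \<le> k}"
      using barred p_in_B unfolding T_eq by (auto simp: order_le_less)
    thus ?thesis
      using True by (simp add: sum plain A_def L_eq exd_form_def)
  next
    case False
    hence "A = {k\<in>T. b p < k}"
      using barred by blast
    moreover have "b p \<in> T" using p_in_B by (simp add: T_eq)
    ultimately show ?thesis
      using False by (simp add: sum plain A_def L_eq exd_form_diff_var)
  qed
qed

lemma prod_first_occurrences:
  fixes n :: nat and b :: "nat \<Rightarrow> 'v" and X Y :: "'v \<Rightarrow> 'a::comm_monoid_mult"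
  defines "m \<equiv> image_mset b (mset_set {1..n})"
  shows "(\<Prod>p\<in>{1..n}. if b p \<in> b ` {1..<p} then Y (b p) else X (b p)) =
    (\<Prod>v\<in>set_mset m. X v) * (\<Prod>v\<in>#repeats m. Y v)"
  unfolding m_def
proof (induction n)
  case 0
  show ?case by (simp add: repeats_def)
next
  case (Suc n)
  have "{1..<Suc n} = {1..n}" by auto
  thus ?case
    using Suc by (simp add: atLeastAtMostSuc_conv repeats_add_mset insert_absorb ac_simps)
qed

lemma sum_exd_perms_eq_mcoeff:
  fixes t :: "'a::comm_ring_1"
  assumes "antimono_on {1..n} b"
  shows "(\<Sum>\<sigma>\<in>exd_perms b n. t ^ exc n \<sigma>) =
    mcoeff (exd_ser t * eser t) (image_mset b (mset_set {1..n}))"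
proof -
  let ?L = "exd_form t (b ` {1..n})" and ?m = "image_mset b (mset_set {1..n})"
  have "(\<Prod>p\<in>{1..n}. \<Sum>c\<in>choices b n p. choice_term t c) =
      (\<Prod>p\<in>{1..n}. if b p \<in> b ` {1..<p} then ?L (b p) else ?L (b p) - mmonom t {#b p#})"
    by (intro prod.cong refl sum_choice_term_eq_exd_form[OF assms])
  also have "\<dots> = (\<Prod>v\<in>set_mset ?m. ?L v - mmonom t {#v#}) * (\<Prod>v\<in>#repeats ?m. ?L v)"
    by (rule prod_first_occurrences)
  finally show ?thesis
    by (simp add: sum_exd_perms_eq_mcoeff_choices[OF assms] mcoeff_exd_ser_mult_eser)
qed

section \<open>Grading by the degree\<close>

lemma mvps_fps_fps_eqI:
  assumes "\<And>n j m. mcoeff (fps_nth (fps_nth f n) j) m = mcoeff (fps_nth (fps_nth g n) j) m"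
  shows "f = (g :: ('v, 'a::comm_ring_1) mvps fps fps)"
  by (intro fps_ext mvps_eqI assms)

definition graded_ser :: "'v set \<Rightarrow> ('v, 'a::comm_ring_1 fps) mvps \<Rightarrow> ('v, 'a) mvps fps fps" where
  "graded_ser V f = Abs_fps (\<lambda>n. Abs_fps (\<lambda>j. Abs_mvps (\<lambda>m.
     if size m = n then fps_nth (mcoeff (restrict_vars V f) m) j else 0)))"

lemma mcoeff_graded_ser_restrict:
  "mcoeff (fps_nth (fps_nth (graded_ser V f) n) j) m =
     (if size m = n then fps_nth (mcoeff (restrict_vars V f) m) j else 0)"
  by (simp add: graded_ser_def)

lemma mcoeff_graded_ser:
  "mcoeff (fps_nth (fps_nth (graded_ser V f) n) j) m =
     (if size m = n \<and> set_mset m \<subseteq> V then fps_nth (mcoeff f m) j else 0)"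
  by (simp add: mcoeff_graded_ser_restrict mcoeff_restrict_vars)

lemma graded_ser_diff: "graded_ser V (f - g) = graded_ser V f - graded_ser V g"
  by (rule mvps_fps_fps_eqI) (simp add: mcoeff_graded_ser)

lemma graded_ser_one: "graded_ser V 1 = 1"
  by (rule mvps_fps_fps_eqI) (auto simp: mcoeff_graded_ser mcoeff_one)

lemma graded_ser_mult: "graded_ser V (f * g) = graded_ser V f * graded_ser V g"
proof (rule mvps_fps_fps_eqI)
  fix n j m
  let ?F = "\<lambda>i p. fps_nth (mcoeff (restrict_vars V f) (fst p)) i"
    and ?G = "\<lambda>i p. fps_nth (mcoeff (restrict_vars V g) (snd p)) i"
  have degree: "(\<Sum>k=0..n. (if size (fst p) = k then ?F i p else 0) *
        (if size (snd p) = n - k then ?G (j - i) p else 0)) =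
      (if size m = n then ?F i p * ?G (j - i) p else 0)" (is "?lhs = ?rhs")
    if "p \<in> msplits m" for i p
  proof -
    have m: "m = fst p + snd p" using that by (auto simp: msplits_def)
    have "?lhs = (\<Sum>k=0..n. if k = size (fst p)
        then ?F i p * (if size (snd p) = n - size (fst p) then ?G (j - i) p else 0) else 0)"
      by (rule sum.cong) auto
    thus ?thesis by (auto simp: m)
  qed
  have "mcoeff (fps_nth (fps_nth (graded_ser V f * graded_ser V g) n) j) m =
      (\<Sum>k=0..n. \<Sum>i=0..j. \<Sum>p\<in>msplits m. (if size (fst p) = k then ?F i p else 0) *
        (if size (snd p) = n - k then ?G (j - i) p else 0))"
    by (simp add: fps_mult_nth fps_sum_nth mcoeff_mult mcoeff_graded_ser_restrict case_prod_unfold)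
  also have "\<dots> = (\<Sum>i=0..j. \<Sum>p\<in>msplits m. \<Sum>k=0..n. (if size (fst p) = k then ?F i p else 0) *
        (if size (snd p) = n - k then ?G (j - i) p else 0))"
    by (subst sum.swap) (rule sum.cong[OF refl sum.swap])
  also have "\<dots> = (\<Sum>i=0..j. \<Sum>p\<in>msplits m. if size m = n then ?F i p * ?G (j - i) p else 0)"
    by (intro sum.cong refl degree)
  also have "\<dots> = (\<Sum>p\<in>msplits m. \<Sum>i=0..j. if size m = n then ?F i p * ?G (j - i) p else 0)"
    by (rule sum.swap)
  also have "\<dots> = mcoeff (fps_nth (fps_nth (graded_ser V (f * g)) n) j) m"
    by (cases "size m = n")
      (simp_all add: mcoeff_graded_ser_restrict restrict_vars_mult mcoeff_mult fps_sum_nth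
        fps_mult_nth case_prod_unfold)
  finally show "mcoeff (fps_nth (fps_nth (graded_ser V (f * g)) n) j) m =
    mcoeff (fps_nth (fps_nth (graded_ser V f * graded_ser V g) n) j) m" ..
qed

lemma graded_ser_dvd_one:
  assumes "f dvd 1"
  shows "graded_ser V f dvd 1"
proof -
  obtain g where "1 = f * g" using assms by (rule dvdE)
  hence "1 = graded_ser V f * graded_ser V g" by (metis graded_ser_mult graded_ser_one)
  thus ?thesis by (rule dvdI)
qed

lemma tvar_eq_graded_ser: "tvar = graded_ser V (mconst fps_X)"
  by (rule mvps_fps_fps_eqI)
    (auto simp: tvar_def mcoeff_graded_ser mcoeff_mmonom mcoeff_one fps_X_def)

lemma mcoeff_hsym: "mcoeff (hsym n) m = (if size m = n \<and> set_mset m \<subseteq> {1..} then 1 else 0)"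
proof -
  have "w = sorted_list_of_multiset m" if "sorted w" "mset w = m" for w
    using that by (metis sorted_list_of_multiset_mset sorted_sort_id)
  hence "{w \<in> {w. length w = n \<and> (\<forall>i\<in>set w. 1 \<le> i) \<and> sorted w}. mset w = m} =
      (if size m = n \<and> set_mset m \<subseteq> {1..} then {sorted_list_of_multiset m} else {})"
    by (auto simp flip: size_mset)
  thus ?thesis by (simp add: hsym_def word_series_def)
qed

lemma Hgen_eq_graded_ser: "Hgen = graded_ser {1..} (hser 1)"
  by (rule mvps_fps_fps_eqI) (simp add: Hgen_def mcoeff_graded_ser mcoeff_hsym hser_def)

lemma Hgen_compose_eq_graded_ser: "fps_compose Hgen (zvar * tvar) = graded_ser {1..} (hser fps_X)"
proof -
  have "fps_compose Hgen (zvar * tvar) = Abs_fps (\<lambda>n. fps_X ^ n * fps_nth Hgen n)"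
    unfolding zvar_def tvar_def mult.commute[of fps_X] by (rule fps_compose_linear)
  thus ?thesis
    by (intro mvps_fps_fps_eqI)
      (simp add: Hgen_def mcoeff_graded_ser mcoeff_hsym hser_def fps_X_power_mult_nth
        fps_X_power_nth)
qed

definition descending_word :: "'v::linorder multiset \<Rightarrow> nat \<Rightarrow> 'v" where
  "descending_word m i = rev (sorted_list_of_multiset m) ! (i - 1)"

lemma antimono_on_descending_word: "antimono_on {1..size m} (descending_word m)"
proof (rule monotone_onI)
  fix i j assume "i \<in> {1..size m}" "j \<in> {1..size m}" "i \<le> j"
  hence "i - 1 \<le> j - 1" "j - 1 < length (rev (sorted_list_of_multiset m))"
    by (auto simp flip: size_mset)
  thus "descending_word m j \<le> descending_word m i"
    unfolding descending_word_def by (intro sorted_rev_nth_mono) simp_all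
qed

lemma image_mset_descending_word: "image_mset (descending_word m) (mset_set {1..size m}) = m"
proof -
  let ?w = "rev (sorted_list_of_multiset m)"
  have len: "length ?w = size m" by (simp flip: size_mset)
  have "mset_set {1..size m} = image_mset Suc (mset_set {0..<size m})"
    by (simp add: image_mset_mset_set atLeastLessThanSuc_atLeastAtMost)
  hence "image_mset (descending_word m) (mset_set {1..size m}) =
      mset (map ((!) ?w) [0..<length ?w])"
    by (simp add: multiset.map_comp comp_def descending_word_def len del: length_rev)
  also have "\<dots> = m" by (simp only: map_nth) simp
  finally show ?thesis .
qed

lemma mcoeff_Fquasi:
  "mcoeff (Fquasi S n) m = (if size m = n \<and> set_mset m \<subseteq> {1..} \<and>
     (\<forall>j\<in>S. descending_word m (Suc j) < descending_word m j) then 1 else 0)"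
proof -
  let ?w = "rev (sorted_list_of_multiset m)"
  have descending: "(\<forall>j\<in>{1..<length w}. w ! j \<le> w ! (j - 1)) \<longleftrightarrow> sorted (rev w)" for w :: "nat list"
  proof -
    have "{1..<length w} = Suc ` {i. Suc i < length w}"
      by (auto simp: image_iff dest!: Suc_le_D)
    thus ?thesis by (simp add: sorted_rev_iff_nth_Suc)
  qed
  have unique: "w = ?w" if "sorted (rev w)" "mset w = m" for w
    using that by (metis mset_rev rev_rev_ident sorted_list_of_multiset_mset sorted_sort_id)
  have "{w \<in> {w. length w = n \<and> (\<forall>i\<in>set w. 1 \<le> i) \<and> (\<forall>j\<in>{1..<n}. w ! j \<le> w ! (j - 1)) \<and>
       (\<forall>j\<in>S. w ! j < w ! (j - 1))}. mset w = m} =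
     {w. sorted (rev w) \<and> mset w = m \<and> length w = n \<and> set w \<subseteq> {1..} \<and>
       (\<forall>j\<in>S. w ! j < w ! (j - 1))}"
    unfolding descending[symmetric] by auto
  also have "\<dots> = (if size m = n \<and> set_mset m \<subseteq> {1..} \<and>
      (\<forall>j\<in>S. descending_word m (Suc j) < descending_word m j) then {?w} else {})"
    unfolding descending_word_def using unique by (auto simp flip: size_mset)
  finally show ?thesis by (simp add: Fquasi_def word_series_def)
qed

lemma mcoeff_Qeuler:
  "mcoeff (Qeuler n j) m = (if size m = n \<and> set_mset m \<subseteq> {1..}
     then fps_nth (mcoeff (exd_ser fps_X * eser fps_X) m) j else 0)"
proof (cases "size m = n \<and> set_mset m \<subseteq> {1..}")
  case True
  let ?P = "exd_perms (descending_word m) n"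
  have "finite {\<sigma>. \<sigma> permutes {1..n}}" by (rule finite_permutations) simp
  hence fin: "finite {\<sigma>. \<sigma> permutes {1..n} \<and> A \<sigma>}" for A
    by (rule rev_finite_subset) blast
  have sum_if: "(\<Sum>\<sigma> | \<sigma> permutes {1..n} \<and> A \<sigma>. if B \<sigma> then 1 else 0) =
      int (card {\<sigma>. (\<sigma> permutes {1..n} \<and> A \<sigma>) \<and> B \<sigma>})" for A B
    using fin by (simp add: sum.If_cases Int_def)
  have "mcoeff (Qeuler n j) m = (\<Sum>\<sigma> | \<sigma> permutes {1..n} \<and> exc n \<sigma> = j.
      if \<forall>i\<in>EXD n \<sigma>. descending_word m (Suc i) < descending_word m i then 1 else 0)"
    using True by (simp add: Qeuler_def mcoeff_Fquasi)
  also have "\<dots> = (\<Sum>\<sigma>\<in>?P. if exc n \<sigma> = j then 1 else 0)"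
    unfolding exd_perms_def sum_if by (simp add: conj_ac)
  also have "\<dots> = fps_nth (\<Sum>\<sigma>\<in>?P. fps_X ^ exc n \<sigma>) j"
    by (simp add: fps_sum_nth fps_X_power_nth eq_commute[of j])
  also have "(\<Sum>\<sigma>\<in>?P. fps_X ^ exc n \<sigma>) =
      mcoeff (exd_ser fps_X * eser (fps_X :: int fps)) m"
    using sum_exd_perms_eq_mcoeff[OF antimono_on_descending_word, of "fps_X :: int fps" m] True
    unfolding image_mset_descending_word by simp
  finally show ?thesis using True by simp
next
  case False
  thus ?thesis by (auto simp: Qeuler_def mcoeff_Fquasi intro!: sum.neutral)
qed

lemma Qgen_eq_graded_ser: "Qgen = graded_ser {1..} (exd_ser fps_X * eser fps_X)"
  by (rule mvps_fps_fps_eqI) (simp add: Qgen_def mcoeff_graded_ser mcoeff_Qeuler)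

lemma one_minus_fps_X_dvd_one: "(1 - fps_X :: 'a::comm_ring_1 fps) dvd 1"
proof (rule dvdI)
  show "1 = (1 - fps_X) * Abs_fps (\<lambda>_. 1 :: 'a)"
    by (rule fps_ext) (simp add: algebra_simps)
qed

theorem theorem2p1:
  shows "(fps_compose Hgen (zvar * tvar) - tvar * Hgen) dvd 1
    \<and> Qgen = unit_quot ((1 - tvar) * Hgen) (fps_compose Hgen (zvar * tvar) - tvar * Hgen)"
proof
  let ?G = "graded_ser {1..} :: (nat, int fps) mvps \<Rightarrow> xps fps fps"
  let ?d = "hser fps_X - mconst fps_X * hser 1"
  note hom = graded_ser_diff graded_ser_mult graded_ser_one
  have numerator: "(1 - tvar) * Hgen = ?G ((1 - mconst fps_X) * hser 1)"
    by (simp add: hom Hgen_eq_graded_ser tvar_eq_graded_ser[of "{1..}"])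
  have denominator: "fps_compose Hgen (zvar * tvar) - tvar * Hgen = ?G ?d"
    unfolding Hgen_compose_eq_graded_ser
    by (simp add: hom Hgen_eq_graded_ser tvar_eq_graded_ser[of "{1..}"])
  show unit: "(fps_compose Hgen (zvar * tvar) - tvar * Hgen) dvd 1"
    unfolding denominator
    by (intro graded_ser_dvd_one hser_diff_dvd_one one_minus_fps_X_dvd_one)
  have "Qgen * (fps_compose Hgen (zvar * tvar) - tvar * Hgen) = (1 - tvar) * Hgen"
    unfolding denominator numerator Qgen_eq_graded_ser
    by (simp only: exd_ser_mult_eser_hser flip: graded_ser_mult)
  thus "Qgen = unit_quot ((1 - tvar) * Hgen) (fps_compose Hgen (zvar * tvar) - tvar * Hgen)"
    by (simp only: unit_quot_eq_iff[OF unit])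
qed

end
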